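(* Let $n\ge1$ and label the poset $[2]\times[n]$ by $(p,j)\mapsto p+2(j-1)$. There is a bijection $\Phi$ from the set of linear extensions of $[2]\times[n]$ to the set $D_n$ of Dyck paths such that, for every linear extension $\sigma$, the descents of $\sigma$ (with respect to this labeling) are in bijection with the high peaks of $\Phi(\sigma)$; in particular $\mathrm{des}(\sigma)=\mathrm{hpea}(\Phi(\sigma))$.
   Context: $[k]$ denotes the $k$-element chain and $[2]\times[n]$ carries the product order $(p,j)\le(p',j')$ iff $p\le p'$ and $j\le j'$. A linear extension is a listing $(q_1,\dots,q_{2n})$ of all elements with $q_i<q_j$ in the poset implying $i<j$; via the labeling it is the word $\sigma_1\cdots\sigma_{2n}$ of labels, and a descent is a position $i$ with $\sigma_{i+1}<\sigma_i$. $D_n$ is the set of lattice paths from $(0,0)$ to $(n,n)$ with steps $e=(1,0)$ and $n=(0,1)$ never going above the line $y=x$. A peak is an occurrence of two consecutive steps $e$ then $n$; it is a low peak if these steps touch the diagonal (i.e. the $e$ step starts on the diagonal) and a high peak otherwise; $\mathrm{hpea}(D)$ is the number of high peaks of $D$. *)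

theory Defs
  imports Main "HOL-Library.Product_Order" "HOL-Library.Product_Plus"
begin

text \<open>The order on pairs is the componentwise one of \<^theory>\<open>HOL-Library.Product_Order\<close>.\<close>

definition chain_prod :: "nat \<Rightarrow> (nat \<times> nat) set" where
  "chain_prod n = {1..2} \<times> {1..n}"

definition linear_extensions :: "'a::order set \<Rightarrow> 'a list set" where
  "linear_extensions P = {qs. distinct qs \<and> set qs = P \<and>
     (\<forall>i<length qs. \<forall>j<length qs. qs ! i < qs ! j \<longrightarrow> i < j)}"

fun label :: "nat \<times> nat \<Rightarrow> nat" where
  "label (p, j) = p + 2 * (j - 1)"

text \<open>List positions start at 0, so the 1-based position \<open>i\<close> of a word (or step of a path)
  is \<open>i - 1\<close> below.\<close>

definition descents :: "nat list \<Rightarrow> nat set" where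
  "descents w = {i. Suc i < length w \<and> w ! Suc i < w ! i}"

definition linext_descents :: "(nat \<times> nat) list \<Rightarrow> nat set" where
  "linext_descents qs = descents (map label qs)"

definition des :: "(nat \<times> nat) list \<Rightarrow> nat" where
  "des qs = card (linext_descents qs)"

datatype step = East | North

fun step_vec :: "step \<Rightarrow> nat \<times> nat" where
  "step_vec East = (1, 0)"
| "step_vec North = (0, 1)"

definition vertex :: "step list \<Rightarrow> nat \<Rightarrow> nat \<times> nat" where
  "vertex D k = sum_list (map step_vec (take k D))"

definition dyck_paths :: "nat \<Rightarrow> step list set" where
  "dyck_paths n = {D. vertex D (length D) = (n, n) \<and>
     (\<forall>k\<le>length D. snd (vertex D k) \<le> fst (vertex D k))}"

definition peaks :: "step list \<Rightarrow> nat set" where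
  "peaks D = {k. Suc k < length D \<and> D ! k = East \<and> D ! Suc k = North}"

definition low_peaks :: "step list \<Rightarrow> nat set" where
  "low_peaks D = {k \<in> peaks D. fst (vertex D k) = snd (vertex D k)}"

definition high_peaks :: "step list \<Rightarrow> nat set" where
  "high_peaks D = peaks D - low_peaks D"

definition hpea :: "step list \<Rightarrow> nat" where
  "hpea D = card (high_peaks D)"

end

theory Submission
  imports Defs
begin

text \<open>Read an element \<open>(1, j)\<close> as an east step and an element \<open>(2, j)\<close> as a north step. As each row
  is a chain, the \<open>j\<close>-th east step must come from \<open>(1, j)\<close> and the \<open>j\<close>-th north step from \<open>(2, j)\<close>,
  which gives the inverse map; the relations \<open>(1, j) < (2, j)\<close> say that the path stays weakly below
  the diagonal. A descent can only occur where \<open>(1, j)\<close> is followed by \<open>(2, k)\<close> with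
  \<open>2 * k < 2 * j - 1\<close>, i.e. at a peak whose east step starts at \<open>(j - 1, k - 1)\<close> with \<open>k < j\<close>.
  So the descents and the high peaks are the same set of positions.\<close>

definition step_of :: "nat \<times> nat \<Rightarrow> step" where
  "step_of q = (if fst q = 1 then East else North)"

text \<open>The vertex is taken at \<open>Suc i\<close> so that step \<open>i\<close> itself is
  counted: the coordinate is then the rank, starting from 1, of this step among those of its
  kind.\<close>

definition path_elem :: "step list \<Rightarrow> nat \<Rightarrow> nat \<times> nat" where
  "path_elem D i = (case D ! i of East \<Rightarrow> (1, fst (vertex D (Suc i)))
                                | North \<Rightarrow> (2, snd (vertex D (Suc i))))"

definition path_word :: "step list \<Rightarrow> (nat \<times> nat) list" where
  "path_word D = map (path_elem D) [0..<length D]"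

lemma length_path_word [simp]: "length (path_word D) = length D"
  by (simp add: path_word_def)

lemma nth_path_word [simp]: "i < length D \<Longrightarrow> path_word D ! i = path_elem D i"
  by (simp add: path_word_def)

lemma vertex_0 [simp]: "vertex D 0 = (0, 0)"
  by (simp add: vertex_def zero_prod_def)

lemma vertex_Suc: "k < length D \<Longrightarrow> vertex D (Suc k) = vertex D k + step_vec (D ! k)"
  by (simp add: vertex_def take_Suc_conv_app_nth)

lemma vertex_mono:
  assumes "i \<le> j" "j \<le> length D"
  shows "fst (vertex D i) \<le> fst (vertex D j) \<and> snd (vertex D i) \<le> snd (vertex D j)"
  using assms
proof (induction j rule: dec_induct)
  case (step m)
  then show ?case by (auto simp: vertex_Suc)
qed simp

text \<open>Every step raises exactly one coordinate by 1. As \<open>dyck_paths\<close> does not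
  mention the length of a path, this is how the endpoint determines it.\<close>

lemma vertex_sum: "k \<le> length D \<Longrightarrow> fst (vertex D k) + snd (vertex D k) = k"
proof (induction k)
  case (Suc k)
  then show ?case by (cases "D ! k") (auto simp: vertex_Suc)
qed simp

lemma path_elem_East:
  "i < length D \<Longrightarrow> D ! i = East \<Longrightarrow> path_elem D i = (1, Suc (fst (vertex D i)))"
  by (simp add: path_elem_def vertex_Suc)

lemma path_elem_North:
  "i < length D \<Longrightarrow> D ! i = North \<Longrightarrow> path_elem D i = (2, Suc (snd (vertex D i)))"
  by (simp add: path_elem_def vertex_Suc)

lemma map_step_of_path_word: "map step_of (path_word D) = D"
proof (rule nth_equalityI)
  fix i assume "i < length (map step_of (path_word D))"
  then show "map step_of (path_word D) ! i = D ! i"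
    by (cases "D ! i") (auto simp: path_elem_East path_elem_North step_of_def)
qed simp

text \<open>Steps of different kinds land in different rows; for two of the same kind, the earlier
  one has already raised the coordinate that gives the later one its rank.\<close>

lemma path_elem_neq:
  assumes "i < j" "j < length D"
  shows "path_elem D i \<noteq> path_elem D j"
  using assms vertex_mono[of "Suc i" j D]
  by (cases "D ! i"; cases "D ! j") (auto simp: path_elem_East path_elem_North vertex_Suc)

lemma distinct_path_word: "distinct (path_word D)"
  unfolding distinct_conv_nth by (metis length_path_word nth_path_word path_elem_neq nat_neq_iff)

lemma path_word_linear_extension:
  assumes D: "D \<in> dyck_paths n"
  shows "path_word D \<in> linear_extensions (chain_prod n)"
proof -
  have end_D: "vertex D (length D) = (n, n)"
    and below: "\<And>k. k \<le> length D \<Longrightarrow> snd (vertex D k) \<le> fst (vertex D k)"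
    using D by (auto simp: dyck_paths_def)
  have len: "length D = 2 * n"
    using vertex_sum[of "length D" D] end_D by simp
  have "path_elem D i \<in> chain_prod n" if "i < length D" for i
    using that vertex_mono[of "Suc i" "length D" D] end_D
    by (cases "D ! i") (auto simp: path_elem_East path_elem_North vertex_Suc chain_prod_def)
  then have sub: "set (path_word D) \<subseteq> chain_prod n"
    by (auto simp: path_word_def)
  \<comment> \<open>Surjectivity by counting: \<open>2 * n\<close> distinct elements inside a set of
    size \<open>2 * n\<close>.\<close>
  have "card (set (path_word D)) = card (chain_prod n)"
    using distinct_card[OF distinct_path_word[of D]] len by (simp add: chain_prod_def)
  then have "set (path_word D) = chain_prod n"
    using card_subset_eq[OF _ sub] by (simp add: chain_prod_def)
  moreover have "i < j"
    if ij: "i < length D" "j < length D" and less: "path_elem D i < path_elem D j" for i j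
  proof (rule ccontr)
    assume "\<not> i < j"
    with less have "j < i" by (cases "i = j") auto
    then show False
      \<comment> \<open>Ranks increase within a row, so only \<open>D ! j = North\<close>,
        \<open>D ! i = East\<close> remains. There the north rank is at most the x-coordinate after
        step \<open>j\<close>, hence below the rank of the later east step.\<close>
      using less ij vertex_mono[of "Suc j" i D] below[of "Suc j"]
      by (cases "D ! i"; cases "D ! j")
        (auto simp: path_elem_East path_elem_North vertex_Suc less_prod_def less_eq_prod_def)
  qed
  ultimately show ?thesis
    using distinct_path_word by (auto simp: linear_extensions_def)
qed

text \<open>Each new entry enlarges the set of exactly one row, by one element because of
  distinctness. The rows are restricted since \<open>step_of\<close> sends every first component
  other than 1 to \<open>North\<close>.\<close>

lemma vertex_map_step_of:
  assumes "distinct qs" "fst ` set qs \<subseteq> {1, 2}" "k \<le> length qs"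
  shows "vertex (map step_of qs) k =
    (card {j. (1, j) \<in> set (take k qs)}, card {j. (2, j) \<in> set (take k qs)})"
  using assms(3)
proof (induction k)
  case (Suc k)
  have fin: "finite {j. (p, j) \<in> set (take k qs)}" for p
    by (rule finite_subset[of _ "snd ` set (take k qs)"]) force+
  obtain p j where q: "qs ! k = (p, j)" by (cases "qs ! k")
  have p: "p = 1 \<or> p = 2"
    using assms(2) nth_mem[of k qs] q Suc.prems by force
  have new: "(p, j) \<notin> set (take k qs)"
    using assms(1) Suc.prems q by (auto simp: in_set_conv_nth nth_eq_iff_index_eq simp flip: q)
  have "{j'. (p', j') \<in> set (take (Suc k) qs)} =
      (if p' = p then insert j {j'. (p', j') \<in> set (take k qs)} else {j'. (p', j') \<in> set (take k qs)})" for p'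
    using Suc.prems q by (auto simp: take_Suc_conv_app_nth)
  then show ?case
    using Suc p q new fin by (auto simp: vertex_Suc step_of_def)
qed (simp)

text \<open>Each row is a chain, so its elements are listed in increasing order. The cardinality
  \<open>j\<close> of this set makes the second component recoverable from the path.\<close>

lemma linear_extension_row_prefix:
  assumes qs: "qs \<in> linear_extensions (chain_prod n)" and i: "i < length qs" "qs ! i = (p, j)"
  shows "{j'. (p, j') \<in> set (take (Suc i) qs)} = {1..j}"
proof -
  have mono: "\<And>i j. i < length qs \<Longrightarrow> j < length qs \<Longrightarrow> qs ! i < qs ! j \<Longrightarrow> i < j"
    and set_qs: "set qs = chain_prod n"
    using qs by (auto simp: linear_extensions_def)
  have pj: "p \<in> {1..2}" "j \<in> {1..n}"
    using nth_mem[OF i(1)] i(2) set_qs by (auto simp: chain_prod_def)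
  show ?thesis
  proof (intro equalityI subsetI)
    fix j' assume "j' \<in> {j'. (p, j') \<in> set (take (Suc i) qs)}"
    then obtain m where m: "m < Suc i" "m < length qs" "qs ! m = (p, j')"
      by (auto simp: in_set_conv_nth)
    then have "1 \<le> j'"
      using nth_mem[of m qs] set_qs by (auto simp: chain_prod_def)
    moreover have "\<not> j < j'"
      using mono[of i m] m i by (auto simp: less_prod_def less_eq_prod_def)
    ultimately show "j' \<in> {1..j}" by simp
  next
    fix j' assume j': "j' \<in> {1..j}"
    then have "(p, j') \<in> set qs"
      using pj by (auto simp: set_qs chain_prod_def)
    then obtain m where m: "m < length qs" "qs ! m = (p, j')"
      by (auto simp: in_set_conv_nth)
    have "m \<le> i"
    proof (cases "j' = j")
      case True
      then show ?thesis
        using qs m i nth_eq_iff_index_eq[of qs m i] by (simp add: linear_extensions_def)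
    next
      case False
      then show ?thesis
        using mono[of m i] m i j' by (auto simp: less_prod_def less_eq_prod_def)
    qed
    then show "j' \<in> {j'. (p, j') \<in> set (take (Suc i) qs)}"
      using m i(1) by (auto simp: in_set_conv_nth intro!: exI[of _ m])
  qed
qed

lemma linear_extension_vertex:
  assumes "qs \<in> linear_extensions (chain_prod n)" "k \<le> length qs"
  shows "vertex (map step_of qs) k =
    (card {j. (1, j) \<in> set (take k qs)}, card {j. (2, j) \<in> set (take k qs)})"
  using assms by (intro vertex_map_step_of) (auto simp: linear_extensions_def chain_prod_def)

lemma path_word_map_step_of:
  assumes qs: "qs \<in> linear_extensions (chain_prod n)"
  shows "path_word (map step_of qs) = qs"
proof (rule nth_equalityI)
  fix i assume "i < length (path_word (map step_of qs))"
  then have i: "i < length qs" by simp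
  obtain p j where q: "qs ! i = (p, j)" by (cases "qs ! i")
  have "p = 1 \<or> p = 2"
    using nth_mem[OF i] q qs by (auto simp: linear_extensions_def chain_prod_def)
  then show "path_word (map step_of qs) ! i = qs ! i"
    using i q linear_extension_row_prefix[OF qs i q] linear_extension_vertex[OF qs, of "Suc i"]
    by (auto simp: path_elem_def step_of_def)
qed simp

lemma map_step_of_dyck_path:
  assumes qs: "qs \<in> linear_extensions (chain_prod n)"
  shows "map step_of qs \<in> dyck_paths n"
proof -
  have mono: "\<And>i j. i < length qs \<Longrightarrow> j < length qs \<Longrightarrow> qs ! i < qs ! j \<Longrightarrow> i < j"
    and set_qs: "set qs = chain_prod n"
    using qs by (auto simp: linear_extensions_def)
  have "{j. (1, j) \<in> chain_prod n} = {1..n}" "{j. (2, j) \<in> chain_prod n} = {1..n}"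
    by (auto simp: chain_prod_def)
  then have "vertex (map step_of qs) (length qs) = (n, n)"
    using linear_extension_vertex[OF qs, of "length qs"] set_qs by simp
  moreover have "snd (vertex (map step_of qs) k) \<le> fst (vertex (map step_of qs) k)"
    if k: "k \<le> length qs" for k
  proof -
    \<comment> \<open>Since (1, j) < (2, j), the row 2 indices seen so far are among those of row 1;
      comparing cardinalities bounds the height by the x-coordinate.\<close>
    have "(1, j) \<in> set (take k qs)" if 2: "(2, j) \<in> set (take k qs)" for j
    proof -
      obtain i where i: "i < k" "qs ! i = (2, j)"
        using 2 by (auto simp: in_set_conv_nth)
      have "(1, j) \<in> set qs"
        using in_set_takeD[OF 2] by (auto simp: set_qs chain_prod_def)
      then obtain m where m: "m < length qs" "qs ! m = (1, j)"
        by (auto simp: in_set_conv_nth)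
      have "m < i"
        using mono[of m i] m i k by (auto simp: less_prod_def less_eq_prod_def)
      then show ?thesis
        using m i by (auto simp: in_set_conv_nth intro!: exI[of _ m])
    qed
    moreover have "finite {j. (1, j) \<in> set (take k qs)}"
      by (rule finite_subset[of _ "snd ` set (take k qs)"]) force+
    ultimately show ?thesis
      using linear_extension_vertex[OF qs k] by (auto intro!: card_mono)
  qed
  ultimately show ?thesis by (simp add: dyck_paths_def)
qed

lemma linext_descents_path_word:
  assumes D: "D \<in> dyck_paths n"
  shows "linext_descents (path_word D) = high_peaks D"
proof -
  have "label (path_elem D (Suc i)) < label (path_elem D i) \<longleftrightarrow>
      D ! i = East \<and> D ! Suc i = North \<and> fst (vertex D i) \<noteq> snd (vertex D i)"
    if i: "Suc i < length D" for i
  proof -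
    \<comment> \<open>At a peak starting at (x, y) the labels are 2x + 1 and 2y + 2, a descent iff y
      < x; the bound at \<open>i\<close> makes this x \<noteq> y. The bound at \<open>Suc i\<close>
      excludes a descent at a north step followed by an east step.\<close>
    have "snd (vertex D i) \<le> fst (vertex D i)" "snd (vertex D (Suc i)) \<le> fst (vertex D (Suc i))"
      using D i by (auto simp: dyck_paths_def)
    then show ?thesis
      using i by (cases "D ! i"; cases "D ! Suc i")
        (auto simp: path_elem_East path_elem_North vertex_Suc)
  qed
  then show ?thesis
    by (auto simp: linext_descents_def descents_def high_peaks_def low_peaks_def peaks_def)
qed

theorem theorem2p1:
  fixes n :: nat
  assumes "n \<ge> 1"
  shows "\<exists>\<Phi>. bij_betw \<Phi> (linear_extensions (chain_prod n)) (dyck_paths n) \<and>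
    (\<forall>\<sigma> \<in> linear_extensions (chain_prod n).
       (\<exists>\<psi>. bij_betw \<psi> (linext_descents \<sigma>) (high_peaks (\<Phi> \<sigma>))) \<and>
       des \<sigma> = hpea (\<Phi> \<sigma>))"
proof (intro exI[of _ "map step_of"] conjI ballI)
  show "bij_betw (map step_of) (linear_extensions (chain_prod n)) (dyck_paths n)"
    by (rule bij_betw_byWitness[where f' = path_word])
      (auto simp: path_word_map_step_of map_step_of_path_word
        map_step_of_dyck_path path_word_linear_extension)
next
  fix \<sigma> assume \<sigma>: "\<sigma> \<in> linear_extensions (chain_prod n)"
  have eq: "linext_descents \<sigma> = high_peaks (map step_of \<sigma>)"
    using linext_descents_path_word[OF map_step_of_dyck_path[OF \<sigma>]]
    by (simp add: path_word_map_step_of[OF \<sigma>])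
  show "\<exists>\<psi>. bij_betw \<psi> (linext_descents \<sigma>) (high_peaks (map step_of \<sigma>))"
    unfolding eq using bij_betw_id by blast
  show "des \<sigma> = hpea (map step_of \<sigma>)"
    by (simp add: des_def hpea_def eq)
qed

end
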